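(* For each of the following pairs $(p,\beta)$ there exist exponentially many infinite binary $\beta^+$-free words containing at most $p$ distinct palindromes: (a) $(11,\tfrac{10}{3})$; (b) $(12,\tfrac{23}{7})$; (c) $(13,3)$; (d) $(15,\tfrac{8}{3})$; (e) $(18,\tfrac{13}{5})$; (f) $(19,\tfrac{28}{11})$; (g) $(21,\tfrac{5}{2})$; (h) $(25,\tfrac{7}{3})$.
   Context: A binary word is a word over $\{\mathtt{0},\mathtt{1}\}$; an infinite word is right-infinite. A finite word is a palindrome if it equals its reversal. The number of palindromes contained in an infinite word is the number of distinct palindromes among its factors, the empty word being counted. For a non-empty word $u$ and a rational $e$, a word $v$ is the $e$-power of $u$ (a repetition with period $u$ and exponent $e$) if $v$ is a prefix of $u^\omega=uuu\cdots$ and $e=|v|/|u|$. A word is $\alpha^+$-free if it contains no factor that is a repetition of exponent strictly greater than $\alpha$. "There exist exponentially many infinite words with a property" means that the number of distinct words of length $n$ occurring as factors of infinite words with this property grows exponentially in $n$, i.e. there is a real $c>1$ such that this number is at least $c^n$ for all sufficiently large $n$. *)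

theory Defs
  imports Complex_Main "HOL-Library.Omega_Words_Fun"
begin

text \<open>
  An infinite word over \<open>'a\<close> is a function \<open>nat \<Rightarrow> 'a\<close>, a finite word is a list. Binary words
  use \<^typ>\<open>bool\<close> as the two-letter alphabet.
\<close>

definition factors :: "'a word \<Rightarrow> 'a list set" where
  "factors w = {w [i \<rightarrow> j] | i j. i \<le> j}"

definition palindrome :: "'a list \<Rightarrow> bool" where
  "palindrome v \<longleftrightarrow> rev v = v"

definition palindromes_of :: "'a word \<Rightarrow> 'a list set" where
  "palindromes_of w = {v \<in> factors w. palindrome v}"

text \<open>Finiteness is required explicitly, since \<^const>\<open>card\<close> is \<open>0\<close> on infinite sets.\<close>

definition has_at_most_palindromes :: "nat \<Rightarrow> 'a word \<Rightarrow> bool" where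
  "has_at_most_palindromes p w \<longleftrightarrow>
     finite (palindromes_of w) \<and> card (palindromes_of w) \<le> p"

text \<open>\<open>is_power v u e\<close>: the word \<open>v\<close> is the \<open>e\<close>-power of \<open>u\<close>.\<close>

definition is_power :: "'a list \<Rightarrow> 'a list \<Rightarrow> rat \<Rightarrow> bool" where
  "is_power v u e \<longleftrightarrow>
     u \<noteq> [] \<and> v = prefix (length v) (u\<^sup>\<omega>) \<and> e = of_nat (length v) / of_nat (length u)"

text \<open>\<open>plus_free a w\<close>: the word \<open>w\<close> is \<open>a\<^sup>+\<close>-free.\<close>

definition plus_free :: "rat \<Rightarrow> 'a word \<Rightarrow> bool" where
  "plus_free a w \<longleftrightarrow> \<not> (\<exists>v \<in> factors w. \<exists>u e. is_power v u e \<and> e > a)"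

definition exponentially_many :: "bool word set \<Rightarrow> bool" where
  "exponentially_many W \<longleftrightarrow>
     (\<exists>c :: real. c > 1 \<and>
        (\<forall>\<^sub>F n in sequentially.
           c ^ n \<le> real (card {v. length v = n \<and> (\<exists>w \<in> W. v \<in> factors w)})))"

end

theory Submission
  imports Defs
begin

text \<open>
  Each of the eight languages contains the images of all square-free ternary words under a suitable
  uniform code of three binary words. The code is synchronizing: a prefix of a code word occurs in
  an encoded word only at the block boundaries. A long repetition therefore has a period that is a
  multiple \<open>q * M\<close> of the block length \<open>q\<close>; since the repeated part cannot contain \<open>M\<close> consecutive
  blocks without yielding a square in the encoded word, its exponent is small. Repetitions of small
  period and palindromes live in images of words of length at most three and are tested by
  evaluation.

  The same argument applies to a synchronizing code that encodes each ternary letter by two ternary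
  words. It shows that the fixed point of one choice of code words is square-free and that
  choosing the code word freely at every position of this fixed point yields exponentially many
  square-free ternary words.
\<close>

section \<open>Runs\<close>

text \<open>A run of length \<open>n\<close> and period \<open>p\<close> corresponds to a factor of length \<open>n + p\<close> with
  period \<open>p\<close>, that is, to a repetition of exponent \<open>(n + p) / p\<close>.\<close>

definition run :: "'a word \<Rightarrow> nat \<Rightarrow> nat \<Rightarrow> nat \<Rightarrow> bool" where
  "run w i p n \<longleftrightarrow> (\<forall>k<n. w (i + k) = w (i + k + p))"

definition square_free :: "'a word \<Rightarrow> bool" where
  "square_free w \<longleftrightarrow> (\<forall>i p. 0 < p \<longrightarrow> \<not> run w i p p)"

lemma runD: "run w i p n \<Longrightarrow> k < n \<Longrightarrow> w (i + k) = w (i + k + p)"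
  by (simp add: run_def)

lemma runD': "run w i p n \<Longrightarrow> i \<le> k \<Longrightarrow> k < i + n \<Longrightarrow> w k = w (k + p)"
  using runD[of w i p n "k - i"] by simp

lemma run_shift: "run w i p n \<Longrightarrow> d + m \<le> n \<Longrightarrow> run w (i + d) p m"
  unfolding run_def by (metis add.assoc add_less_cancel_left less_le_trans)

lemma square_free_adjacent: "square_free w \<Longrightarrow> w i \<noteq> w (Suc i)"
  unfolding square_free_def run_def
  by (metis One_nat_def Suc_eq_plus1 add.right_neutral less_Suc0 zero_less_one)

text \<open>A run of length \<open>n\<close> and period \<open>p\<close> has exponent
  \<open>(n + p) / p\<close>; clearing denominators in \<open>(n + p) / p \<le> N / D\<close> gives
  the linear bound.\<close>

lemma plus_freeI:
  assumes D: "0 < D" "D \<le> N"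
    and run: "\<And>i p n. 0 < p \<Longrightarrow> run w i p n \<Longrightarrow> D * n \<le> (N - D) * p"
  shows "plus_free (of_nat N / of_nat D) w"
  unfolding plus_free_def
proof (rule notI, elim bexE exE conjE)
  fix v u e
  assume "v \<in> factors w" and pow: "is_power v u e" and e: "of_nat N / of_nat D < e"
  then obtain i j where v: "v = w [i \<rightarrow> j]"
    by (auto simp: factors_def)
  \<comment> \<open>The subtraction truncates to 0 when \<open>v\<close> is shorter than
    \<open>u\<close>, hence only the inequality \<open>length v \<le> n + p\<close> below.\<close>
  define p n where "p = length u" and "n = length v - p"
  have p: "0 < p" and v_eq: "v = prefix (length v) (u\<^sup>\<omega>)"
    and e_eq: "e = of_nat (length v) / of_nat p"
    using pow by (auto simp: is_power_def p_def)
  have nth: "w (i + k) = u ! (k mod p)" if "k < length v" for k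
  proof -
    have "w (i + k) = v ! k"
      using that by (simp add: v subsequence_def)
    also have "\<dots> = (u\<^sup>\<omega>) k"
      by (subst v_eq) (use that in \<open>simp add: subsequence_def\<close>)
    finally show ?thesis
      using p by (simp add: p_def)
  qed
  have "run w i p n"
    unfolding run_def
  proof (intro allI impI)
    fix k assume "k < n"
    then show "w (i + k) = w (i + k + p)"
      using nth[of k] nth[of "k + p"] by (simp add: n_def add.assoc)
  qed
  then have "D * n \<le> (N - D) * p"
    using run p by blast
  moreover have "length v \<le> n + p"
    by (simp add: n_def)
  ultimately have "D * length v \<le> (N - D) * p + D * p"
    by (metis add_mono_thms_linordered_semiring(3) distrib_left mult_le_mono2 order_trans)
  then have "D * length v \<le> N * p"
    using D by (simp add: diff_mult_distrib)
  then have "(of_nat (D * length v) :: rat) \<le> of_nat (N * p)"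
    using of_nat_le_iff by blast
  then have "e \<le> of_nat N / of_nat D"
    using p D by (simp add: e_eq field_simps)
  with e show False
    by simp
qed


section \<open>Images under uniform codes\<close>

definition morph :: "nat \<Rightarrow> ('a \<Rightarrow> 'b list) \<Rightarrow> 'a word \<Rightarrow> 'b word" where
  "morph q h w n = h (w (n div q)) ! (n mod q)"

lemma div_bounds:
  fixes q :: nat
  assumes "0 < q"
  shows "q * (n div q) \<le> n" "n < q * (n div q) + q"
  using mult_div_mod_eq[of q n] mod_less_divisor[OF assms, of n] by linarith+

lemma morph_nth: "r < q \<Longrightarrow> morph q h w (q * j + r) = h (w j) ! r"
  by (simp add: morph_def)

lemma nth_window2:
  assumes "\<And>a. length (h a) = q" "r < 2 * q"
  shows "(h (w j) @ h (w (Suc j))) ! r = morph q h w (q * j + r)"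
proof (cases "r < q")
  case False
  then have "q * j + r = q * Suc j + (r - q)"
    by simp
  with False assms show ?thesis
    using morph_nth[of "r - q" q h w "Suc j"] by (simp add: nth_append)
qed (simp add: assms nth_append morph_nth)

lemma nth_window3:
  assumes len: "\<And>a. length (h a) = q" and r: "r < 3 * q"
  shows "(h (w j) @ h (w (Suc j)) @ h (w (Suc (Suc j)))) ! r = morph q h w (q * j + r)"
proof (cases "r < q")
  case False
  then have eq: "q * j + r = q * Suc j + (r - q)"
    by simp
  have "(h (w (Suc j)) @ h (w (Suc (Suc j)))) ! (r - q) = morph q h w (q * Suc j + (r - q))"
    by (rule nth_window2) (use len r False in auto)
  with False eq show ?thesis
    by (simp add: nth_append len)
qed (simp add: assms nth_append morph_nth)

text \<open>The map \<open>f\<close> forgets a decoration of the letters: only square-freeness of \<open>f \<circ> w\<close> is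
  required of the word \<open>w\<close> to be encoded, so one letter may have several code words.\<close>

locale sync_code =
  fixes f :: "'a \<Rightarrow> 'c" and h :: "'a \<Rightarrow> 'b list" and q l s t :: nat
  assumes length_code [simp]: "length (h a) = q"
    and l: "0 < l" "l \<le> q" and s: "0 < s" "s \<le> q" and t: "0 < t" "t \<le> q"
    and sync: "f a \<noteq> f b \<Longrightarrow> 0 < r \<Longrightarrow> r < q \<Longrightarrow> take l (drop r (h a @ h b)) \<noteq> take l (h c)"
    and prefix_code: "take t (h a) = take t (h b) \<Longrightarrow> f a = f b"
    and suffix_code: "drop (q - s) (h a) = drop (q - s) (h b) \<Longrightarrow> f a = f b"
begin

lemma q_pos: "0 < q"
  using l by simp

text \<open>A run of length at least \<open>q + l - 1\<close> contains the first \<open>l\<close>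
  letters of some block. Shifted by \<open>p\<close> they recur at offset \<open>p mod q\<close> of
  a block, and synchronization leaves only offset 0.\<close>

lemma period_dvd:
  assumes run: "run (morph q h w) i p n" and n: "q + l \<le> Suc n"
    and adj: "\<And>j. f (w j) \<noteq> f (w (Suc j))"
  shows "q dvd p"
proof (rule ccontr)
  assume "\<not> q dvd p"
  \<comment> \<open>Division rounding up: block \<open>c\<close> is the first to start at or after
    \<open>i\<close>.\<close>
  define c r d where "c = (i + q - 1) div q" and "r = p mod q" and "d = c + p div q"
  have r: "0 < r" "r < q"
    using \<open>\<not> q dvd p\<close> q_pos by (auto simp: r_def mod_greater_zero_iff_not_dvd)
  have c: "i \<le> q * c" "q * c < i + q"
    using div_bounds[OF q_pos, of "i + q - 1"] q_pos unfolding c_def by linarith+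
  have eq: "q * c + p = q * d + r"
    by (simp add: d_def r_def algebra_simps)
  have "take l (drop r (h (w d) @ h (w (Suc d)))) = take l (h (w c))"
  proof (rule nth_equalityI)
    fix k assume "k < length (take l (drop r (h (w d) @ h (w (Suc d)))))"
    then have k: "k < l" "k < q"
      using l by auto
    then have "take l (drop r (h (w d) @ h (w (Suc d)))) ! k = morph q h w (q * d + (r + k))"
      using r by (subst nth_window2[symmetric]) (auto simp del: drop_append take_append)
    also have "\<dots> = morph q h w (q * c + k + p)"
      using eq by (metis add.assoc add.commute)
    also have "\<dots> = morph q h w (q * c + k)"
      using runD'[OF run, of "q * c + k"] c k n by simp
    also have "\<dots> = take l (h (w c)) ! k"
      using k by (simp add: morph_nth)
    finally show "take l (drop r (h (w d) @ h (w (Suc d)))) ! k = take l (h (w c)) ! k" .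
  qed (use r l in auto)
  with sync[OF adj r] show False
    by blast
qed

text \<open>The run compares blocks at distance \<open>M\<close>. Of the first block its last
  \<open>s\<close> letters suffice to identify the class, of the last block its first
  \<open>t\<close> letters, so this length reaches \<open>M\<close> consecutive blocks.\<close>

lemma period_multiple:
  assumes run: "run (morph q h w) i (q * M) n" and M: "0 < M"
    and n: "q \<le> n" "(M - 1) * q + s + t \<le> Suc n"
  shows "\<exists>j. run (f \<circ> w) j M M"
proof -
  have sh: "morph q h w (q * j + r) = morph q h w (q * (j + M) + r)"
    if "i \<le> q * j + r" "q * j + r < i + n" for j r
    using runD'[OF run that] by (simp add: algebra_simps)
  have suf: "f (w j) = f (w (j + M))" if "i + s \<le> q * j + q" "q * j + q \<le> i + n" for j
  proof (rule suffix_code, rule nth_equalityI)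
    fix k assume "k < length (drop (q - s) (h (w j)))"
    then have k: "k < s" using s by simp
    define r where "r = q - s + k"
    have r: "r < q" "i \<le> q * j + r" "q * j + r < i + n"
      using that s k by (simp_all add: r_def)
    have "h (w j) ! r = h (w (j + M)) ! r"
      using sh[of j r] r morph_nth[of r q h w] by simp
    then show "drop (q - s) (h (w j)) ! k = drop (q - s) (h (w (j + M))) ! k"
      by (simp add: r_def)
  qed simp
  have pre: "f (w j) = f (w (j + M))" if "i \<le> q * j" "q * j + t \<le> i + n" for j
  proof (rule prefix_code, rule nth_equalityI)
    fix k assume "k < length (take t (h (w j)))"
    then have "k < t" "k < q" using t by simp_all
    then show "take t (h (w j)) ! k = take t (h (w (j + M))) ! k"
      using sh[of j k] that by (simp add: morph_nth)
  qed simp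
  \<comment> \<open>Block \<open>j\<close> is the first whose last \<open>s\<close> letters all lie
    at or after \<open>i\<close>.\<close>
  define j where "j = (i + s - 1) div q"
  have j: "q * j < i + s" "i + s \<le> q * j + q"
    using div_bounds[OF q_pos, of "i + s - 1"] s unfolding j_def by linarith+
  have "f (w (j + k)) = f (w (j + k + M))" if "k < M" for k
  proof (cases k)
    case 0
    show ?thesis
    proof (cases "q * j + q \<le> i + n")
      case True
      with suf j 0 show ?thesis by simp
    next
      case False
      \<comment> \<open>The run ends before block \<open>j\<close> does. Being at least
        \<open>q\<close> long it also contains the start of that block, so the prefix
        decides.\<close>
      with pre[of j] j n 0 show ?thesis by simp
    qed
  next
    case (Suc k')
    have "q * k \<le> (M - 1) * q"
      unfolding mult.commute[of q] using that by (intro mult_le_mono1) simp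
    moreover have "q \<le> q * k"
      using Suc by simp
    ultimately have "i \<le> q * (j + k)" "q * (j + k) + t \<le> i + n"
      using j n unfolding add_mult_distrib2 by linarith+
    then show ?thesis
      by (rule pre)
  qed
  then show ?thesis
    by (auto simp: run_def)
qed

end


section \<open>Executable tests\<close>

text \<open>In the tests, \<open>if\<close> rather than conjunction makes the simplifier evaluate lazily.\<close>

fun no_run :: "nat \<Rightarrow> nat \<Rightarrow> 'b list \<Rightarrow> 'b list \<Rightarrow> bool" where
  "no_run m k (x # xs) (y # ys) =
     (if x = y then (case k of 0 \<Rightarrow> False | Suc k' \<Rightarrow> no_run m k' xs ys) else no_run m m xs ys)"
| "no_run m k [] ys = True"
| "no_run m k (x # xs) [] = True"

text \<open>Called with two equal lists, this shifts the second by one more letter per entry, so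
  \<open>ms ! j\<close> is the budget for period \<open>j + 1\<close>.\<close>

fun no_runs :: "'b list \<Rightarrow> 'b list \<Rightarrow> nat list \<Rightarrow> bool" where
  "no_runs xs ys [] = True"
| "no_runs xs ys (m # ms) =
     (if no_run m m xs (tl ys) then no_runs xs (tl ys) ms else False)"

fun starts :: "'b list \<Rightarrow> 'b list \<Rightarrow> bool" where
  "starts [] ys = True"
| "starts (x # xs) [] = False"
| "starts (x # xs) (y # ys) = (if x = y then starts xs ys else False)"

fun avoids :: "'b list list \<Rightarrow> nat \<Rightarrow> 'b list \<Rightarrow> bool" where
  "avoids vs 0 ys = True"
| "avoids vs (Suc n) ys = (if list_ex (\<lambda>v. starts v ys) vs then False else avoids vs n (tl ys))"

text \<open>Taking \<open>tl\<close> and \<open>q - 1\<close> starting positions tests exactly the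
  offsets strictly inside the first block. Triples with \<open>b = c\<close> are skipped because
  neighbouring letters of the encoded word differ.\<close>

definition pair_ok ::
  "nat \<Rightarrow> nat \<Rightarrow> nat \<Rightarrow> nat \<Rightarrow> nat list \<Rightarrow> ('c \<times> 'b list) list \<Rightarrow> 'b list \<Rightarrow> 'c \<Rightarrow> 'b list \<Rightarrow> bool"
where
  "pair_ok q l s t ms cs x b y \<longleftrightarrow>
     (if take t x = take t y then False
      else if drop (q - s) x = drop (q - s) y then False
      else if avoids (map (\<lambda>(c, z). take l z) cs) (q - 1) (tl (x @ y))
      then list_all (\<lambda>(c, z). if b = c then True else no_runs (x @ y @ z) (x @ y @ z) ms) cs
      else False)"

definition code_ok ::
  "nat \<Rightarrow> nat \<Rightarrow> nat \<Rightarrow> nat \<Rightarrow> nat list \<Rightarrow> ('c \<times> 'b list) list \<Rightarrow> bool" where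
  "code_ok q l s t ms cs \<longleftrightarrow>
     list_all (\<lambda>(a, x). length x = q) cs \<and>
     list_all (\<lambda>(a, x). list_all (\<lambda>(b, y).
       if a = b then True else pair_ok q l s t ms cs x b y) cs) cs"

section \<open>Soundness of the run and synchronization tests\<close>

text \<open>In \<open>no_run\<close>, \<open>k\<close> is the number of agreements still allowed
  before the next mismatch, which resets it to \<open>m\<close>. Only a stretch at the very front is
  therefore limited by \<open>k\<close>.\<close>

lemma no_run_bound:
  assumes "no_run m k xs ys" "k \<le> m" "r + n \<le> length xs" "r + n \<le> length ys"
    and "\<And>i. i < n \<Longrightarrow> xs ! (r + i) = ys ! (r + i)"
  shows "n \<le> (if r = 0 then k else m)"
  using assms
proof (induction m k xs ys arbitrary: r n rule: no_run.induct)
  case (1 m k x xs y ys)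
  show ?case
  proof (cases r)
    case 0
    show ?thesis
    proof (cases n)
      case (Suc n')
      then have "x = y"
        using "1.prems"(5)[of 0] 0 by simp
      with "1.prems"(1) obtain k' where k: "k = Suc k'" "no_run m k' xs ys"
        by (cases k) auto
      have "n' \<le> (if (0::nat) = 0 then k' else m)"
      proof (rule "1.IH"(1)[OF \<open>x = y\<close> k])
        show "xs ! (0 + i) = ys ! (0 + i)" if "i < n'" for i
          using "1.prems"(5)[of "Suc i"] that 0 Suc by simp
      qed (use "1.prems" k 0 Suc in auto)
      with 0 Suc k show ?thesis by simp
    qed simp
  next
    case (Suc r')
    have eq: "xs ! (r' + i) = ys ! (r' + i)" if "i < n" for i
      using "1.prems"(5)[of i] that Suc by simp
    have "n \<le> m"
    proof (cases "x = y")
      case True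
      with "1.prems"(1) obtain k' where k: "k = Suc k'" "no_run m k' xs ys"
        by (cases k) auto
      have "n \<le> (if r' = 0 then k' else m)"
        by (rule "1.IH"(1)[OF \<open>x = y\<close> k]) (use "1.prems" k Suc eq in auto)
      with k "1.prems"(2) show ?thesis by (auto split: if_splits)
    next
      case False
      with "1.prems"(1) have "no_run m m xs ys" by simp
      then have "n \<le> (if r' = 0 then m else m)"
        by (rule "1.IH"(2)[OF False]) (use "1.prems" Suc eq in auto)
      then show ?thesis by simp
    qed
    with Suc show ?thesis by simp
  qed
qed auto

lemma no_runs_nth:
  "no_runs xs ys ms \<Longrightarrow> j < length ms \<Longrightarrow> no_run (ms ! j) (ms ! j) xs (drop (Suc j) ys)"
proof (induction xs ys ms arbitrary: j rule: no_runs.induct)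
  case (2 xs ys m ms)
  then show ?case
    by (cases j) (auto simp: drop_Suc split: if_splits)
qed simp

lemma starts_iff: "starts v ys \<longleftrightarrow> take (length v) ys = v"
  by (induction v ys rule: starts.induct) auto

lemma avoidsD:
  "avoids vs n ys \<Longrightarrow> v \<in> set vs \<Longrightarrow> r < n \<Longrightarrow> take (length v) (drop r ys) \<noteq> v"
proof (induction vs n ys arbitrary: r rule: avoids.induct)
  case (2 vs n ys)
  then show ?case
    by (cases r) (auto simp: starts_iff list_ex_iff drop_Suc split: if_splits)
qed simp

lemma code_ok_pairD:
  assumes "code_ok q l s t ms (map (\<lambda>a. (f a, h a)) as)" "set as = UNIV" "f a \<noteq> f b"
  shows "pair_ok q l s t ms (map (\<lambda>a. (f a, h a)) as) (h a) (f b) (h b)"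
  using assms by (simp add: code_ok_def list_all_iff)

lemma code_ok_sync_code:
  assumes ok: "code_ok q l s t ms (map (\<lambda>a. (f a, h a)) as)" and as: "set as = UNIV"
    and "0 < l" "l \<le> q" "0 < s" "s \<le> q" "0 < t" "t \<le> q"
  shows "sync_code f h q l s t"
proof
  have len: "length (h a) = q" for a
    using ok as by (auto simp: code_ok_def list_all_iff)
  show "length (h a) = q" for a
    by (rule len)
  have pair: "take t (h a) \<noteq> take t (h b) \<and> drop (q - s) (h a) \<noteq> drop (q - s) (h b) \<and>
      avoids (map (\<lambda>c. take l (h c)) as) (q - 1) (tl (h a @ h b))" if "f a \<noteq> f b" for a b
    using code_ok_pairD[OF ok as that] by (simp add: pair_ok_def comp_def split: if_splits)
  show "f a = f b" if "take t (h a) = take t (h b)" for a b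
    using pair that by blast
  show "f a = f b" if "drop (q - s) (h a) = drop (q - s) (h b)" for a b
    using pair that by blast
  show "take l (drop r (h a @ h b)) \<noteq> take l (h c)" if "f a \<noteq> f b" "0 < r" "r < q" for a b c r
  proof -
    obtain r' where r: "r = Suc r'" "r' < q - 1"
      using \<open>0 < r\<close> \<open>r < q\<close> by (cases r) auto
    have "take (length (take l (h c))) (drop r' (tl (h a @ h b))) \<noteq> take l (h c)"
      using pair[OF \<open>f a \<noteq> f b\<close>] r(2) as by (intro avoidsD[of _ "q - 1"]) auto
    then show ?thesis
      using r len[of c] \<open>l \<le> q\<close> by (simp add: drop_Suc del: tl_append drop_append)
  qed
qed (use assms in auto)

text \<open>A run starting late in its block need not fit into three blocks. Dropping its part in the
  first block then costs at most \<open>p + m - 2 * q\<close> letters (truncated subtraction).\<close>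

lemma code_ok_run_bound:
  assumes ok: "code_ok q l s t ms (map (\<lambda>a. (f a, h a)) as)" and as: "set as = UNIV"
    and q: "0 < q" and adj: "\<And>j. f (w j) \<noteq> f (w (Suc j))"
    and run: "run (morph q h w) i p n" and p: "0 < p" "p \<le> length ms"
    and m: "m = ms ! (p - 1)" "p + m < 3 * q"
  shows "n \<le> m + (p + m - 2 * q)"
proof (rule ccontr)
  assume n: "\<not> n \<le> m + (p + m - 2 * q)"
  have len: "length (h a) = q" for a
    using ok as by (auto simp: code_ok_def list_all_iff)
  have no: False
    if R: "run (morph q h w) (q * j + r) p (Suc m)" and r: "r + Suc m + p \<le> 3 * q" for j r
  proof -
    let ?u = "h (w j) @ h (w (Suc j)) @ h (w (Suc (Suc j)))"
    have "no_runs ?u ?u ms"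
      using code_ok_pairD[OF ok as adj[of j]] adj[of "Suc j"] as
      by (simp add: pair_ok_def list_all_iff split: if_splits)
    from no_runs_nth[OF this, of "p - 1"] have "no_run m m ?u (drop p ?u)"
      using p m by simp
    then have "Suc m \<le> (if r = 0 then m else m)"
    proof (rule no_run_bound)
      show "?u ! (r + k) = drop p ?u ! (r + k)" if "k < Suc m" for k
      proof -
        have "?u ! (r + k) = morph q h w (q * j + (r + k))"
          by (rule nth_window3) (use that r len in auto)
        also have "\<dots> = morph q h w (q * j + (p + (r + k)))"
          using runD[OF R that] by (simp add: algebra_simps)
        also have "\<dots> = ?u ! (p + (r + k))"
          by (rule nth_window3[symmetric]) (use that r len in auto)
        also have "\<dots> = drop p ?u ! (r + k)"
          using that r by (subst nth_drop) (auto simp: len)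
        finally show ?thesis .
      qed
    qed (use r len in auto)
    then show False
      by simp
  qed
  define j r where "j = i div q" and "r = i mod q"
  have i: "i = q * j + r" "r < q"
    using q by (simp_all add: j_def r_def)
  show False
  proof (cases "r + Suc m + p \<le> 3 * q")
    case True
    have "run (morph q h w) (i + 0) p (Suc m)"
      using run by (rule run_shift) (use n in simp)
    with no[OF _ True] i show False
      by simp
  next
    case False
    have "run (morph q h w) (i + (q - r)) p (Suc m)"
      using run by (rule run_shift) (use n False in simp)
    moreover have "i + (q - r) = q * Suc j + 0"
      using i by simp
    ultimately show False
      using no[of "Suc j" 0] m by simp
  qed
qed

section \<open>Palindromes in images under a uniform code\<close>

text \<open>Removing both end letters of a palindrome leaves a palindrome, so it suffices to avoid the
  minimal palindromes outside a given list.\<close>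

definition palindrome_ext :: "bool list list \<Rightarrow> bool list list" where
  "palindrome_ext vs = filter (\<lambda>v. v \<notin> set vs)
     ([[True], [False]] @ concat (map (\<lambda>v. [True # v @ [True], False # v @ [False]]) ([] # vs)))"

text \<open>A word of length at most \<open>q + 1\<close> that starts in a block ends at the latest
  with the next one, so pairs of blocks suffice.\<close>

definition palindromes_ok :: "nat \<Rightarrow> bool list list \<Rightarrow> bool list list \<Rightarrow> bool" where
  "palindromes_ok q vs xs \<longleftrightarrow>
     list_all (\<lambda>v. length v \<le> Suc q) (palindrome_ext vs) \<and>
     list_all (\<lambda>x. list_all (\<lambda>y.
       if x = y then True else avoids (palindrome_ext vs) q (x @ y)) xs) xs"

lemma palindrome_Cons_snoc: "palindrome (x # v @ [y]) \<Longrightarrow> y = x \<and> palindrome v"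
  unfolding palindrome_def rev.simps rev_append append.simps list.inject by (metis append1_eq_conv)

lemma palindromes_of_subset:
  assumes "\<And>v. v \<in> set (palindrome_ext vs) \<Longrightarrow> v \<notin> factors w"
  shows "palindromes_of w \<subseteq> set ([] # vs)"
proof -
  have "w [i \<rightarrow> j] \<in> set ([] # vs)" if "palindrome (w [i \<rightarrow> j])" for i j
    using that
  proof (induction "j - i" arbitrary: i j rule: less_induct)
    case less
    let ?v = "w [i \<rightarrow> j]"
    let ?E = "[[True], [False]] @
      concat (map (\<lambda>v. [True # v @ [True], False # v @ [False]]) ([] # vs))"
    \<comment> \<open>Empty factors may have \<open>i > j\<close>, whereas \<open>factors\<close>
      asks for ordered ends.\<close>
    have "?v = w [i \<rightarrow> max i j]"
      by (simp add: subsequence_def max_def)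
    then have fac: "?v \<in> factors w"
      unfolding factors_def by (metis (mono_tags, lifting) max.cobounded1 mem_Collect_eq)
    have ext: "?v \<in> set vs" if "?v \<in> set ?E"
    proof (rule ccontr)
      assume "?v \<notin> set vs"
      with that have "?v \<in> {v \<in> set ?E. v \<notin> set vs}"
        by (intro CollectI conjI)
      then have "?v \<in> set (palindrome_ext vs)"
        by (simp only: palindrome_ext_def set_filter)
      with assms fac show False
        by blast
    qed
    have "j \<le> i \<or> j = Suc i \<or> (\<exists>j'. j = Suc j' \<and> i < j')"
      by (cases j) auto
    then consider "j \<le> i" | "j = Suc i" | j' where "j = Suc j'" "i < j'"
      by blast
    then show ?case
    proof cases
      case 1
      then show ?thesis by (simp add: subsequence_def)
    next
      case 2
      then have "?v = [w i]" by (simp add: subsequence_def)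
      then show ?thesis using ext by (cases "w i") auto
    next
      case 3
      let ?u = "w [Suc i \<rightarrow> j']"
      have v: "?v = w i # ?u @ [w j']"
        using 3 by (simp add: subsequence_def upt_conv_Cons)
      have ends: "w j' = w i" and pal: "palindrome ?u"
        using palindrome_Cons_snoc[OF less.prems[unfolded v]] by simp_all
      have "j' - Suc i < j - i"
        using 3 by simp
      from less.hyps[OF this pal] have "w i # ?u @ [w i] \<in> set ?E"
        by (cases "w i") auto
      then show ?thesis
        using ext unfolding v ends by simp
    qed
  qed
  then show ?thesis
    unfolding palindromes_of_def factors_def by blast
qed

text \<open>The successor counts the empty palindrome.\<close>

lemma palindromes_ok_bound:
  assumes ok: "palindromes_ok q vs (map h as)" and as: "set as = UNIV"
    and len: "\<And>a. length (h a) = q" and q: "0 < q"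
    and adj: "\<And>j. h (w j) \<noteq> h (w (Suc j))"
  shows "has_at_most_palindromes (Suc (length vs)) (morph q h w)"
proof -
  have sub: "palindromes_of (morph q h w) \<subseteq> set ([] # vs)"
  proof (rule palindromes_of_subset, rule notI)
    fix v assume v: "v \<in> set (palindrome_ext vs)" and "v \<in> factors (morph q h w)"
    then obtain i j where ij: "v = morph q h w [i \<rightarrow> j]"
      by (auto simp: factors_def)
    define b r where "b = i div q" and "r = i mod q"
    have i: "i = q * b + r" "r < q"
      using q by (simp_all add: b_def r_def)
    let ?u = "h (w b) @ h (w (Suc b))"
    have "length v \<le> Suc q"
      using ok v by (auto simp: palindromes_ok_def list_all_iff)
    have "take (length v) (drop r ?u) = v"
    proof (rule nth_equalityI)
      show "length (take (length v) (drop r ?u)) = length v"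
        using len i \<open>length v \<le> Suc q\<close> by simp
      fix k assume "k < length (take (length v) (drop r ?u))"
      then have k: "k < length v" "r + k < 2 * q"
        using len i by auto
      then have "take (length v) (drop r ?u) ! k = ?u ! (r + k)"
        using len i by (simp del: drop_append take_append)
      also have "\<dots> = morph q h w (q * b + (r + k))"
        by (rule nth_window2) (use len k in auto)
      finally show "take (length v) (drop r ?u) ! k = v ! k"
        using k ij i by (simp add: subsequence_def add.assoc)
    qed
    moreover have "avoids (palindrome_ext vs) q ?u"
      using ok as adj[of b] by (auto simp: palindromes_ok_def list_all_iff)
    ultimately show False
      using avoidsD v i(2) by blast
  qed
  then have "card (palindromes_of (morph q h w)) \<le> card (set ([] # vs))"
    by (intro card_mono) simp_all
  also have "\<dots> \<le> Suc (length vs)"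
    using card_length[of "[] # vs"] by simp
  finally show ?thesis
    using sub finite_subset by (auto simp: has_at_most_palindromes_def)
qed


section \<open>A family of ternary square-free words\<close>

datatype letter = A | B | C

fun rot :: "letter \<Rightarrow> letter" where
  "rot A = B" | "rot B = C" | "rot C = A"

text \<open>Every code word begins and ends with the letter it encodes. The choice between the two
  words of a letter carries one free bit.\<close>

fun ternary_code :: "letter \<times> bool \<Rightarrow> letter list" where
  "ternary_code (a, d) = map (case a of A \<Rightarrow> id | B \<Rightarrow> rot | C \<Rightarrow> rot \<circ> rot)
     (if d then [A, B, C, A, C, B, C, A, B, A, C, A, B, C, A, C, B, A]
      else [A, B, C, A, C, B, A, C, A, B, A, C, B, C, A, C, B, A])"

text \<open>The bound \<open>p - 1\<close> on runs of period \<open>p\<close> would be enough to exclude squares, but the stronger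
  bound \<open>13\<close>, which happens to hold, is needed to see the run within three blocks.\<close>

definition ternary_budgets :: "nat list" where
  "ternary_budgets = [0..<14] @ replicate 13 13"

definition decorated_letters :: "(letter \<times> bool) list" where
  "decorated_letters = [(A, False), (A, True), (B, False), (B, True), (C, False), (C, True)]"

lemma set_decorated_letters: "set decorated_letters = UNIV"
proof -
  have "(a, d) \<in> set decorated_letters" for a d
    by (cases a; cases d) (simp_all add: decorated_letters_def)
  then show ?thesis by auto
qed

text \<open>Either end letter identifies the encoded letter up to its decoration, whence
  \<open>s = t = 1\<close>.\<close>

lemma ternary_code_ok:
  "code_ok 18 11 1 1 ternary_budgets (map (\<lambda>a. (fst a, ternary_code a)) decorated_letters)"
  by code_simp

lemma inj_ternary_code: "inj ternary_code"
proof -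
  have "distinct (map ternary_code decorated_letters)"
    by code_simp
  then show ?thesis
    by (simp add: distinct_map set_decorated_letters)
qed

interpretation ternary: sync_code fst ternary_code 18 11 1 1
  by (rule code_ok_sync_code[OF ternary_code_ok set_decorated_letters]) simp_all

text \<open>Periods up to 27 are excluded by the test. From \<open>28 = 18 + 11 - 1\<close> on, the
  run is long enough to force a multiple of 18, and the square descends to a shorter one in the
  encoded word.\<close>

lemma ternary_square:
  assumes adj: "\<And>j. fst (w j) \<noteq> fst (w (Suc j))"
    and run: "run (morph 18 ternary_code w) i p p" and p: "0 < p"
  shows "\<exists>M j. 0 < M \<and> M < p \<and> run (fst \<circ> w) j M M"
proof (cases "p \<le> 27")
  case True
  then have m: "ternary_budgets ! (p - 1) = min (p - 1) 13"
    using p by (simp add: ternary_budgets_def nth_append)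
  have "p \<le> ternary_budgets ! (p - 1) + (p + ternary_budgets ! (p - 1) - 2 * 18)"
    by (rule code_ok_run_bound[OF ternary_code_ok set_decorated_letters _ adj run p _ refl])
      (use True m in \<open>simp_all add: ternary_budgets_def\<close>)
  with m p True show ?thesis
    by (simp add: min_def split: if_splits)
next
  case False
  have "18 dvd p"
    using False by (intro ternary.period_dvd[OF run _ adj]) simp
  then obtain M where M: "p = 18 * M" ..
  have "\<exists>j. run (fst \<circ> w) j M M"
    by (rule ternary.period_multiple[of w i M p]) (use run M p in simp_all)
  with M p show ?thesis
    by auto
qed

text \<open>The fixed point, starting with \<open>A\<close>, of the morphism that uses the
  undecorated code words. Position 0 has its own clause because it lies in its own block.\<close>

function base :: "letter word" where
  "base n = (if n = 0 then A else ternary_code (base (n div 18), False) ! (n mod 18))"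
  by auto
termination
  by (relation "measure id") auto

declare base.simps [simp del]

lemma base_morph: "base = morph 18 ternary_code (\<lambda>i. (base i, False))"
proof
  fix n
  show "base n = morph 18 ternary_code (\<lambda>i. (base i, False)) n"
  proof (cases "n = 0")
    case True
    then show ?thesis
      by (simp add: morph_def base.simps[of 0])
  qed (simp add: morph_def base.simps[of n])
qed

text \<open>Inside a block this is a property of the code words. Across a boundary the two letters
  are those encoded by the adjacent blocks, so the claim reduces to a smaller position.\<close>

lemma base_adjacent: "base n \<noteq> base (Suc n)"
proof (induction n rule: less_induct)
  case (less n)
  let ?c = "\<lambda>a. ternary_code (a, False)"
  have inner: "distinct_adj (?c a)" and ends: "?c a ! 0 = a" "?c a ! 17 = a" for a
    by (cases a; simp)+
  define j r where "j = n div 18" and "r = n mod 18"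
  have n: "n = 18 * j + r" "r < 18"
    by (simp_all add: j_def r_def)
  have base: "base (18 * j + r) = ?c (base j) ! r" if "r < 18" for j r
    using morph_nth[OF that, of ternary_code "\<lambda>i. (base i, False)" j] by (simp flip: base_morph)
  show ?case
  proof (cases "r = 17")
    case True
    have "base n = base j"
      using base[of 17 j] n True ends by simp
    moreover have "base (Suc n) = base (Suc j)"
      using base[of 0 "Suc j"] n True ends by simp
    moreover have "j < n"
      using n True by simp
    ultimately show ?thesis
      using less.IH by simp
  next
    case False
    then have "?c (base j) ! r \<noteq> ?c (base j) ! Suc r"
      using inner[of "base j"] n ternary.length_code[of "(base j, False)"]
      by (simp add: distinct_adj_conv_nth)
    then show ?thesis
      using base[of r j] base[of "Suc r" j] n False by simp
  qed
qed

text \<open>Infinite descent: \<open>base\<close> is its own preimage, so any square in it yields a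
  shorter one.\<close>

lemma square_free_base: "square_free base"
proof -
  have "\<not> run base i p p" if "0 < p" for i p
    using that
  proof (induction p arbitrary: i rule: less_induct)
    case (less p)
    show ?case
    proof
      assume "run base i p p"
      then have "run (morph 18 ternary_code (\<lambda>i. (base i, False))) i p p"
        by (simp flip: base_morph)
      from ternary_square[OF _ this less.prems] obtain M j
        where "0 < M" "M < p" "run base j M M"
        using base_adjacent by (auto simp: comp_def)
      with less.IH show False
        by blast
    qed
  qed
  then show ?thesis
    by (simp add: square_free_def)
qed

definition ternary_word :: "bool word \<Rightarrow> letter word" where
  "ternary_word d = morph 18 ternary_code (\<lambda>i. (base i, d i))"

lemma square_free_ternary_word: "square_free (ternary_word d)"
  unfolding square_free_def
proof (intro allI impI notI)
  fix i p :: nat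
  assume "0 < p" "run (ternary_word d) i p p"
  then obtain M j where "0 < M" "run base j M M"
    using ternary_square[of "\<lambda>i. (base i, d i)" i p] base_adjacent
    by (auto simp: ternary_word_def comp_def)
  with square_free_base show False
    by (auto simp: square_free_def)
qed


section \<open>Binary codes\<close>

text \<open>Each bit of \<open>d\<close> costs \<open>K\<close> letters, so at least
  \<open>2 ^ (n div K)\<close> factors of length \<open>n\<close> occur.\<close>

lemma exponentially_manyI:
  assumes K: "0 < K" and W: "\<And>d. X d \<in> W"
    and inj: "\<And>d d' N j. prefix (K * N) (X d) = prefix (K * N) (X d') \<Longrightarrow> j < N \<Longrightarrow> d j = (d' j :: bool)"
  shows "exponentially_many W"
proof -
  \<comment> \<open>The factor 2 absorbs the rounding: \<open>n div K\<close> is at least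
    \<open>n / (2 * K)\<close> once \<open>2 * K \<le> n\<close>.\<close>
  define c :: real where "c = 2 powr (1 / (2 * K))"
  let ?F = "\<lambda>n. {v. length v = n \<and> (\<exists>w \<in> W. v \<in> factors w)}"
  have card: "2 ^ N \<le> card (?F n)" if N: "N = n div K" for n N
  proof -
    let ?L = "{d :: bool list. length d = N}"
    \<comment> \<open>A finite bit list is continued by \<open>False\<close>.\<close>
    let ?g = "\<lambda>d. prefix n (X (\<lambda>i. i < N \<and> d ! i))"
    have KN: "K * N \<le> n"
      by (simp add: N)
    have "inj_on ?g ?L"
    proof (rule inj_onI)
      fix d d' assume d: "d \<in> ?L" "d' \<in> ?L" and eq: "?g d = ?g d'"
      have "prefix (K * N) (X (\<lambda>i. i < N \<and> d ! i)) = prefix (K * N) (X (\<lambda>i. i < N \<and> d' ! i))"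
        using arg_cong[OF eq, of "take (K * N)"] KN by (simp add: subsequence_def take_map)
      from inj[OF this] d show "d = d'"
        by (auto intro!: nth_equalityI)
    qed
    moreover have "?g ` ?L \<subseteq> ?F n"
      using W by (fastforce simp: factors_def subsequence_length)
    moreover have "finite (?F n)"
      by (rule finite_subset[OF _ finite_lists_length_eq[of UNIV n]]) auto
    ultimately have "card ?L \<le> card (?F n)"
      by (rule card_inj_on_le)
    moreover have "card ?L = 2 ^ N"
      using card_lists_length_eq[of "UNIV :: bool set" N] by simp
    ultimately show ?thesis
      by simp
  qed
  have "c ^ n \<le> card (?F n)" if n: "2 * K \<le> n" for n
  proof -
    have "n < K * (n div K) + K"
      using div_bounds(2)[OF K] .
    then have "n \<le> 2 * (K * (n div K))"
      using n by linarith
    then have "real n \<le> 2 * real K * real (n div K)"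
      by (metis (mono_tags) mult.assoc of_nat_le_iff of_nat_mult of_nat_numeral)
    then have le: "real n / (2 * K) \<le> real (n div K)"
      using K by (simp add: field_simps)
    have "c ^ n = 2 powr (real n / (2 * K))"
      by (simp add: c_def powr_realpow[symmetric] powr_powr)
    also have "\<dots> \<le> 2 powr (real (n div K))"
      using le by (intro powr_mono) auto
    also have "\<dots> = real (2 ^ (n div K))"
      by (simp add: powr_realpow)
    also have "\<dots> \<le> card (?F n)"
      using card[OF refl, of n] of_nat_le_iff by blast
    finally show ?thesis .
  qed
  moreover have "1 < c"
    using K by (simp add: c_def)
  ultimately show ?thesis
    unfolding exponentially_many_def eventually_sequentially by blast
qed

section \<open>Decoding, and a criterion for binary codes\<close>

lemma morph_inj:
  assumes len: "\<And>a. length (h a) = q" and "inj h"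
    and eq: "\<And>n. n < q * k \<Longrightarrow> morph q h w n = morph q h w' n" and j: "j < k"
  shows "w j = w' j"
proof -
  have "h (w j) = h (w' j)"
  proof (rule nth_equalityI)
    fix r assume "r < length (h (w j))"
    then have r: "r < q" by (simp add: len)
    have "q * Suc j \<le> q * k"
      using j by (intro mult_le_mono2) simp
    with r have "q * j + r < q * k"
      by simp
    from eq[OF this] r show "h (w j) ! r = h (w' j) ! r"
      by (simp add: morph_nth)
  qed (simp add: len)
  with \<open>inj h\<close> show ?thesis
    by (rule injD)
qed

text \<open>The entry for period \<open>p\<close> is the greatest run length compatible with
  exponent \<open>N / D\<close>.\<close>

definition budgets :: "nat \<Rightarrow> nat \<Rightarrow> nat \<Rightarrow> nat list" where
  "budgets N D P = map (\<lambda>p. (N - D) * p div D) [1..<Suc P]"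

text \<open>Periods up to \<open>P\<close> are tested. For a larger period, a run exceeding its
  budget is long enough for \<open>period_dvd\<close> by the first condition on \<open>P\<close>;
  then square-freeness of the ternary word limits the run.\<close>

lemma exponentially_many_code:
  assumes ok: "code_ok q l s t (budgets N D P) [(A, x), (B, y), (C, z)]"
    and pal: "palindromes_ok q vs [x, y, z]"
    and lst: "0 < l" "l \<le> q" "0 < s" "s \<le> q" "0 < t" "t \<le> q"
    and D: "0 < D" "2 * D \<le> N"
    and P: "q + l \<le> (N - D) * Suc P div D + 2" "P + (N - D) * P div D \<le> 2 * q"
    and st: "D * (s + t - 2) \<le> (N - D) * q"
    and \<beta>: "\<beta> = of_nat N / of_nat D" and k: "k = Suc (length vs)"
  shows "exponentially_many {w. plus_free \<beta> w \<and> has_at_most_palindromes k w}"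
proof -
  define h where "h = case_letter x y z"
  let ?as = "[A, B, C]"
  have UNIV: "set ?as = UNIV"
    using letter.exhaust by auto
  have ok': "code_ok q l s t (budgets N D P) (map (\<lambda>a. (id a, h a)) ?as)"
    using ok by (simp add: h_def)
  interpret sync_code id h q l s t
    using code_ok_sync_code[OF ok' UNIV lst] .
  have inj: "inj h"
    using prefix_code by (auto intro!: injI)
  define X where "X d = morph q h (ternary_word d)" for d
  have "X d \<in> {w. plus_free \<beta> w \<and> has_at_most_palindromes k w}" for d
  proof (intro CollectI conjI)
    let ?w = "ternary_word d"
    have sf: "square_free ?w"
      by (rule square_free_ternary_word)
    have adj: "id (?w j) \<noteq> id (?w (Suc j))" for j
      using square_free_adjacent[OF sf] by simp
    show "has_at_most_palindromes k (X d)"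
      unfolding X_def k
    proof (rule palindromes_ok_bound[where as = ?as])
      show "palindromes_ok q vs (map h ?as)"
        using pal by (simp add: h_def)
      show "h (?w j) \<noteq> h (?w (Suc j))" for j
        using injD[OF inj] adj[of j] by auto
    qed (use UNIV q_pos in simp_all)
    show "plus_free \<beta> (X d)"
      unfolding \<beta>
    proof (rule plus_freeI)
      fix i p n assume p: "0 < p" and run: "run (X d) i p n"
      show "D * n \<le> (N - D) * p"
      proof (rule ccontr)
        assume "\<not> D * n \<le> (N - D) * p"
        then have n: "(N - D) * p div D < n"
          using D by (simp add: div_less_iff_less_mult mult.commute)
        show False
        proof (cases "p \<le> P")
          case True
          have m: "(N - D) * p div D = budgets N D P ! (p - 1)"
            using True p by (cases p) (simp_all add: budgets_def del: upt_Suc)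
          have "(N - D) * p div D \<le> (N - D) * P div D"
            using True by (intro div_le_mono mult_le_mono2)
          then have le: "p + (N - D) * p div D \<le> 2 * q"
            using True P by linarith
          \<comment> \<open>By the second condition on \<open>P\<close> the truncated correction
            term is 0.\<close>
          then have "n \<le> (N - D) * p div D + (p + (N - D) * p div D - 2 * q)"
            using run True p q_pos
            by (intro code_ok_run_bound[where f = id and h = h and w = ?w,
                  OF ok' UNIV q_pos adj _ _ _ m])
              (simp_all add: X_def budgets_def)
          with le n show False by simp
        next
          case False
          then have "(N - D) * Suc P div D \<le> (N - D) * p div D"
            by (intro div_le_mono mult_le_mono2) simp
          with n P have n': "q + l \<le> Suc n" by linarith
          with run adj have "q dvd p"
            unfolding X_def by (intro period_dvd)
          then obtain M where M: "p = q * M" ..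
          have "0 < M" using p M by simp
          have "\<nexists>j. run (id \<circ> ?w) j M M"
            using sf \<open>0 < M\<close> by (simp add: square_free_def)
          with period_multiple[of ?w i M n] run \<open>0 < M\<close> n' lst M
          have "Suc n < (M - 1) * q + s + t"
            by (force simp: X_def)
          then have "n \<le> (M - 1) * q + (s + t - 2)"
            by linarith
          then have "D * n \<le> D * ((M - 1) * q) + D * (s + t - 2)"
            by (metis distrib_left mult_le_mono2)
          \<comment> \<open>The \<open>M - 1\<close> full blocks are paid for by
            \<open>D \<le> N - D\<close>, the remaining \<open>s + t - 2\<close> letters by
            \<open>st\<close>.\<close>
          also have "\<dots> \<le> (N - D) * ((M - 1) * q) + (N - D) * q"
            using st D by (intro add_mono mult_le_mono1) simp_all
          also have "\<dots> = (N - D) * p"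
            using \<open>0 < M\<close> M by (cases M) (simp_all add: algebra_simps)
          finally show False
            using \<open>\<not> D * n \<le> (N - D) * p\<close> by simp
        qed
      qed
    qed (use D in simp_all)
  qed
  \<comment> \<open>Decoding twice: \<open>q\<close> binary letters per ternary letter and 18
    ternary letters per bit.\<close>
  moreover have "d j = d' j"
    if eq: "prefix (q * 18 * N) (X d) = prefix (q * 18 * N) (X d')" and j: "j < N" for d d' N j
  proof -
    have "X d n = X d' n" if "n < q * (18 * N)" for n
      using arg_cong[OF eq, of "\<lambda>v. v ! n"] that by (simp add: subsequence_def)
    then have "ternary_word d k = ternary_word d' k" if "k < 18 * N" for k
      using that unfolding X_def by (rule morph_inj[rotated 2]) (simp_all add: inj)
    then have "(base j, d j) = (base j, d' j)"
      using j unfolding ternary_word_def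
      by (rule morph_inj[rotated 2]) (use inj_ternary_code ternary.length_code in simp_all)
    then show ?thesis by simp
  qed
  ultimately show ?thesis
    using q_pos by (intro exponentially_manyI[of "q * 18" X]) simp_all
qed

section \<open>The eight binary codes and their palindromes\<close>

text \<open>The code words below were found by a computer search.\<close>

definition bits :: "string \<Rightarrow> bool list" where
  "bits s = map (\<lambda>c. c = CHR ''1'') s"

text \<open>In each of the eight codes \<open>P\<close> is the least value meeting the first
  condition on \<open>P\<close>; here \<open>7 * 30 div 3 + 2 = 58 + 14\<close>.\<close>

lemma code_11_ok:
  "code_ok 58 14 28 46 (budgets 10 3 29)
     [(A, bits ''0010111001011100101100101100101110010110010110010111001011''),
      (B, bits ''0010111001011100101100101100101110010110010111001011001011''),
      (C, bits ''0010111001011100101100101110010110010110010111001011001011'')]"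
  unfolding budgets_def[of 10 3 29, simplified] by code_simp

text \<open>Ten non-empty palindromes are allowed, the empty word being the eleventh; the other
  lists are likewise one short of the bound.\<close>

lemma palindromes_11_ok:
  "palindromes_ok 58
    (map bits [''0'', ''1'', ''00'', ''11'', ''010'', ''101'', ''111'', ''0110'', ''1001'', ''01110''])
    [bits ''0010111001011100101100101100101110010110010110010111001011'',
     bits ''0010111001011100101100101100101110010110010111001011001011'',
     bits ''0010111001011100101100101110010110010110010111001011001011'']"
  by code_simp

lemma code_12_ok:
  "code_ok 67 18 30 55 (budgets 23 7 36)
     [(A, bits ''1101000111010001110100011010001101000111010001101000110100011101000''),
      (B, bits ''1101000111010001110100011010001101000111010001101000111010001101000''),
      (C, bits ''1101000111010001110100011010001110100011010001101000111010001101000'')]"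
  unfolding budgets_def[of 23 7 36, simplified] by code_simp

lemma palindromes_12_ok:
  "palindromes_ok 67
    (map bits [''0'', ''1'', ''00'', ''11'', ''000'', ''010'', ''101'', ''111'', ''0110'', ''01110'',
      ''10001''])
    [bits ''1101000111010001110100011010001101000111010001101000110100011101000'',
     bits ''1101000111010001110100011010001101000111010001101000111010001101000'',
     bits ''1101000111010001110100011010001110100011010001101000111010001101000'']"
  by code_simp

lemma code_13_ok:
  "code_ok 20 4 10 13 (budgets 3 1 10)
     [(A, bits ''01110001011001011001''),
      (B, bits ''01110010110001011001''),
      (C, bits ''01110010110010110001'')]"
  unfolding budgets_def[of 3 1 10, simplified] by code_simp

lemma palindromes_13_ok:
  "palindromes_ok 20
    (map bits [''0'', ''1'', ''00'', ''11'', ''000'', ''010'', ''101'', ''111'', ''0110'', ''1001'',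
      ''01110'', ''10001''])
    [bits ''01110001011001011001'',
     bits ''01110010110001011001'',
     bits ''01110010110010110001'']"
  by code_simp

lemma code_15_ok:
  "code_ok 51 10 18 25 (budgets 8 3 35)
     [(A, bits ''110110010110010010110110010010110010010110110010010''),
      (B, bits ''110110010110110010010110010010110110010010110010010''),
      (C, bits ''110110010110110010010110110010010110010110110010010'')]"
  unfolding budgets_def[of 8 3 35, simplified] by code_simp

lemma palindromes_15_ok:
  "palindromes_ok 51
    (map bits [''0'', ''1'', ''00'', ''11'', ''010'', ''101'', ''0110'', ''1001'', ''00100'', ''11011'',
      ''010010'', ''101101'', ''0110110'', ''1001001''])
    [bits ''110110010110010010110110010010110010010110110010010'',
     bits ''110110010110110010010110010010110110010010110010010'',
     bits ''110110010110110010010110110010010110010110110010010'']"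
  by code_simp

lemma code_18_ok:
  "code_ok 72 16 17 48 (budgets 13 5 53)
     [(A, bits ''011010110010110101100110010110011001011010110010110011001011010110011001''),
      (B, bits ''011010110010110101100110010110011001011010110011001011010110010110011001''),
      (C, bits ''011010110010110101100110010110101100101100110010110101100110010110011001'')]"
  unfolding budgets_def[of 13 5 53, simplified] by code_simp

lemma palindromes_18_ok:
  "palindromes_ok 72
    (map bits [''0'', ''1'', ''00'', ''11'', ''010'', ''101'', ''0110'', ''1001'', ''10101'', ''001100'',
      ''101101'', ''110011'', ''1101011'', ''01011010'', ''01100110'', ''10011001'',
      ''011010110''])
    [bits ''011010110010110101100110010110011001011010110010110011001011010110011001'',
     bits ''011010110010110101100110010110011001011010110011001011010110010110011001'',
     bits ''011010110010110101100110010110101100101100110010110101100110010110011001'']"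
  by code_simp

lemma code_19_ok:
  "code_ok 76 15 31 37 (budgets 28 11 57)
     [(A, bits ''1011010110010110101100101001011001010010110101100101001011001011010110010100''),
      (B, bits ''1011010110010110101100101001011001011010110010100101101011001010010110010100''),
      (C, bits ''1011010110010110101100101001011010110010100101100101101011001010010110010100'')]"
  unfolding budgets_def[of 28 11 57, simplified] by code_simp

lemma palindromes_19_ok:
  "palindromes_ok 76
    (map bits [''0'', ''1'', ''00'', ''11'', ''010'', ''101'', ''0110'', ''1001'', ''01010'', ''10101'',
      ''010010'', ''101101'', ''0010100'', ''1101011'', ''01011010'', ''10100101'',
      ''011010110'', ''100101001''])
    [bits ''1011010110010110101100101001011001010010110101100101001011001011010110010100'',
     bits ''1011010110010110101100101001011001011010110010100101101011001010010110010100'',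
     bits ''1011010110010110101100101001011010110010100101100101101011001010010110010100'']"
  by code_simp

lemma code_21_ok:
  "code_ok 30 5 15 19 (budgets 5 2 21)
     [(A, bits ''001001100110100110011011001011''),
      (B, bits ''001001100110100110110011001011''),
      (C, bits ''001001100110110010110011001011'')]"
  unfolding budgets_def[of 5 2 21, simplified] by code_simp

lemma palindromes_21_ok:
  "palindromes_ok 30
    (map bits [''0'', ''1'', ''00'', ''11'', ''010'', ''101'', ''0110'', ''1001'', ''00100'', ''11011'',
      ''001100'', ''110011'', ''0110110'', ''1001001'', ''01100110'', ''10011001'',
      ''001101100'', ''110010011'', ''01100100110'', ''10011011001''])
    [bits ''001001100110100110011011001011'',
     bits ''001001100110100110110011001011'',
     bits ''001001100110110010110011001011'']"
  by code_simp

lemma code_25_ok: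
  "code_ok 36 5 22 28 (budgets 7 3 29)
     [(A, bits ''001011001001101100110100110010011011''),
      (B, bits ''001011001001101100110100110110010011''),
      (C, bits ''001011001101100100110100110010011011'')]"
  unfolding budgets_def[of 7 3 29, simplified] by code_simp

lemma palindromes_25_ok:
  "palindromes_ok 36
    (map bits [''0'', ''1'', ''00'', ''11'', ''010'', ''101'', ''0110'', ''1001'', ''00100'', ''11011'',
      ''001100'', ''110011'', ''0110110'', ''1001001'', ''01100110'', ''10011001'',
      ''001101100'', ''110010011'', ''0100110010'', ''1011001101'', ''01100100110'',
      ''10011011001'', ''0100110110010'', ''1011001001101''])
    [bits ''001011001001101100110100110010011011'',
     bits ''001011001001101100110100110110010011'',
     bits ''001011001101100100110100110010011011'']"
  by code_simp

theorem theorem3: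
  fixes p :: nat and \<beta> :: rat
  assumes "(p, \<beta>) \<in> {(11, 10/3), (12, 23/7), (13, 3), (15, 8/3),
                     (18, 13/5), (19, 28/11), (21, 5/2), (25, 7/3)}"
  shows "exponentially_many {w :: bool word. plus_free \<beta> w \<and> has_at_most_palindromes p w}"
proof -
  have c11: "exponentially_many {w. plus_free (10/3) w \<and> has_at_most_palindromes 11 w}"
    by (rule exponentially_many_code[OF code_11_ok palindromes_11_ok]) simp_all
  have c12: "exponentially_many {w. plus_free (23/7) w \<and> has_at_most_palindromes 12 w}"
    by (rule exponentially_many_code[OF code_12_ok palindromes_12_ok]) simp_all
  have c13: "exponentially_many {w. plus_free 3 w \<and> has_at_most_palindromes 13 w}"
    by (rule exponentially_many_code[OF code_13_ok palindromes_13_ok]) simp_all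
  have c15: "exponentially_many {w. plus_free (8/3) w \<and> has_at_most_palindromes 15 w}"
    by (rule exponentially_many_code[OF code_15_ok palindromes_15_ok]) simp_all
  have c18: "exponentially_many {w. plus_free (13/5) w \<and> has_at_most_palindromes 18 w}"
    by (rule exponentially_many_code[OF code_18_ok palindromes_18_ok]) simp_all
  have c19: "exponentially_many {w. plus_free (28/11) w \<and> has_at_most_palindromes 19 w}"
    by (rule exponentially_many_code[OF code_19_ok palindromes_19_ok]) simp_all
  have c21: "exponentially_many {w. plus_free (5/2) w \<and> has_at_most_palindromes 21 w}"
    by (rule exponentially_many_code[OF code_21_ok palindromes_21_ok]) simp_all
  have c25: "exponentially_many {w. plus_free (7/3) w \<and> has_at_most_palindromes 25 w}"
    by (rule exponentially_many_code[OF code_25_ok palindromes_25_ok]) simp_all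
  show ?thesis
    using assms c11 c12 c13 c15 c18 c19 c21 c25 by blast
qed

end
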